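(* There exist positive integers $m,n$, partitions $\mu\subseteq\lambda$ (each written with $n$ non-negative parts), and an integer vector $w=(w_1,\dots,w_m)$ such that the polytope $\mathcal{G}^\ast_{\lambda/\mu,w}$, defined as the convex hull of the integer points of the polytope $\mathcal{G}_{\lambda/\mu,w}$, does not satisfy the integer decomposition property.
   Context: Gelfand--Tsetlin polytopes: fix positive integers $m,n$ and partitions $\lambda=(\lambda_1\ge\dots\ge\lambda_n\ge 0)$ and $\mu=(\mu_1\ge\dots\ge\mu_n\ge 0)$ with $\mu_i\le\lambda_i$ for all $i$. Consider arrays of non-negative real numbers $(x^i_j)$ with $0\le i\le m$, $1\le j\le n$; the entries $x^i_1,\dots,x^i_n$ form row $i$. The polytope $\mathcal{G}_{\lambda/\mu}$ (which also depends on $m$) is the set of all such arrays satisfying $$x^{i+1}_j\ge x^i_j \quad\text{and}\quad x^i_j\ge x^{i+1}_{j+1}$$ for all $i,j$ for which both entries are defined, with top row $x^m_j=\lambda_j$ and bottom row $x^0_j=\mu_j$ for $1\le j\le n$. For an integer vector $w=(w_1,\dots,w_m)$, $\mathcal{G}_{\lambda/\mu,w}$ is the set of points of $\mathcal{G}_{\lambda/\mu}$ which additionally satisfy $\sum_{j=1}^n x^i_j=w_i$ for each $1\le i\le m$. This polytope is not integral in general. An integral polytope $\mathcal{P}\subset\mathbb{R}^d$ (one whose vertices are all in $\mathbb{Z}^d$) has the integer decomposition property if for every positive integer $k$ and every $\mathbf{x}\in k\mathcal{P}\cap\mathbb{Z}^d$ there are $\mathbf{x}_1,\dots,\mathbf{x}_k\in\mathcal{P}\cap\mathbb{Z}^d$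 with $\mathbf{x}_1+\dots+\mathbf{x}_k=\mathbf{x}$. *)

theory Defs
  imports "HOL-Analysis.Analysis" "HOL-Analysis.Finite_Function_Topology"
begin

(* An array (x^i_j), 0 <= i <= m and 1 <= j <= n, is a finitely supported function on pairs
   (i, j) that vanishes outside the index set.  This embeds R^((m+1)n) as a coordinate subspace
   of a single real vector space, so that m and n can be quantified inside a formula. *)
type_synonym array = "(nat \<times> nat) \<Rightarrow>\<^sub>0 real"

abbreviation entry :: "array \<Rightarrow> nat \<Rightarrow> nat \<Rightarrow> real"
  where "entry x i j \<equiv> Poly_Mapping.lookup x (i, j)"

definition integer_points :: "('i \<Rightarrow>\<^sub>0 real) set"
  where "integer_points = {x. \<forall>p. Poly_Mapping.lookup x p \<in> \<int>}"

definition integral_polytope :: "('i \<Rightarrow>\<^sub>0 real) set \<Rightarrow> bool"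
  where "integral_polytope P \<longleftrightarrow> polytope P \<and> (\<forall>v. v extreme_point_of P \<longrightarrow> v \<in> integer_points)"

(* A property of integral polytopes P.  Integrality is deliberately not a conjunct here: otherwise
   the negation would also hold for a non-integral P.  See gt_integer_hull_integral below. *)
definition integer_decomposition_property :: "('i \<Rightarrow>\<^sub>0 real) set \<Rightarrow> bool"
  where "integer_decomposition_property P \<longleftrightarrow>
    (\<forall>k::nat. 0 < k \<longrightarrow>
      (\<forall>x \<in> (\<lambda>z. real k *\<^sub>R z) ` P \<inter> integer_points.
        \<exists>y :: nat \<Rightarrow> ('i \<Rightarrow>\<^sub>0 real).
          (\<forall>l\<in>{1..k}. y l \<in> P \<inter> integer_points) \<and> (\<Sum>l=1..k. y l) = x))"

(* Partitions with n non-negative parts are functions on nat; only the values at 1, ..., n matter. *)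
definition is_partition :: "nat \<Rightarrow> (nat \<Rightarrow> nat) \<Rightarrow> bool"
  where "is_partition n p \<longleftrightarrow> (\<forall>j. 1 \<le> j \<and> j < n \<longrightarrow> p (j + 1) \<le> p j)"

definition gt_polytope :: "nat \<Rightarrow> nat \<Rightarrow> (nat \<Rightarrow> nat) \<Rightarrow> (nat \<Rightarrow> nat) \<Rightarrow> array set"
  where "gt_polytope m n lam mu = {x.
      Poly_Mapping.keys x \<subseteq> {0..m} \<times> {1..n} \<and>
      (\<forall>i\<in>{0..m}. \<forall>j\<in>{1..n}. 0 \<le> entry x i j) \<and>
      (\<forall>i j. i < m \<and> 1 \<le> j \<and> j \<le> n \<longrightarrow> entry x (i + 1) j \<ge> entry x i j) \<and>
      (\<forall>i j. i < m \<and> 1 \<le> j \<and> j < n \<longrightarrow> entry x i j \<ge> entry x (i + 1) (j + 1)) \<and>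
      (\<forall>j\<in>{1..n}. entry x m j = real (lam j)) \<and>
      (\<forall>j\<in>{1..n}. entry x 0 j = real (mu j))}"

definition gt_weight_polytope ::
    "nat \<Rightarrow> nat \<Rightarrow> (nat \<Rightarrow> nat) \<Rightarrow> (nat \<Rightarrow> nat) \<Rightarrow> (nat \<Rightarrow> int) \<Rightarrow> array set"
  where "gt_weight_polytope m n lam mu w =
    {x \<in> gt_polytope m n lam mu. \<forall>i\<in>{1..m}. (\<Sum>j=1..n. entry x i j) = of_int (w i)}"

definition gt_integer_hull ::
    "nat \<Rightarrow> nat \<Rightarrow> (nat \<Rightarrow> nat) \<Rightarrow> (nat \<Rightarrow> nat) \<Rightarrow> (nat \<Rightarrow> int) \<Rightarrow> array set"
  where "gt_integer_hull m n lam mu w = convex hull (gt_weight_polytope m n lam mu w \<inter> integer_points)"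

lemma gt_polytope_entry_le_top:
  assumes x: "x \<in> gt_polytope m n lam mu" and j: "j \<in> {1..n}" and "i \<le> m"
  shows "entry x i j \<le> real (lam j)"
  using \<open>i \<le> m\<close>
proof (induction rule: inc_induct)
  case base
  then show ?case using x j by (simp add: gt_polytope_def)
next
  case (step i)
  have "entry x i j \<le> entry x (Suc i) j"
    using x j step.hyps by (simp add: gt_polytope_def)
  then show ?case using step.IH by linarith
qed

lemma finite_gt_integer_points: "finite (gt_polytope m n lam mu \<inter> integer_points)"
proof -
  let ?I = "{0..m} \<times> {1..n}"
  let ?A = "gt_polytope m n lam mu \<inter> integer_points"
  let ?f = "\<lambda>x::array. restrict (Poly_Mapping.lookup x) ?I"
  let ?B = "PiE ?I (\<lambda>p. of_int ` {0..int (lam (snd p))} :: real set)"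
  have "?f ` ?A \<subseteq> ?B"
  proof (rule image_subsetI, rule restrict_PiE_iff[THEN iffD2], rule ballI)
    fix x p assume x: "x \<in> ?A" and p: "p \<in> ?I"
    obtain i j where ij: "p = (i, j)" "i \<le> m" "j \<in> {1..n}" using p by auto
    have "Poly_Mapping.lookup x p \<in> \<int>" using x ij by (simp add: integer_points_def)
    then obtain z where z: "Poly_Mapping.lookup x p = of_int z" by (auto elim: Ints_cases)
    have "0 \<le> entry x i j" using x ij by (simp add: gt_polytope_def)
    moreover have "entry x i j \<le> real (lam j)" using gt_polytope_entry_le_top x ij by blast
    ultimately have "z \<in> {0..int (lam (snd p))}" using z ij by simp
    then show "Poly_Mapping.lookup x p \<in> of_int ` {0..int (lam (snd p))}" using z by blast
  qed
  moreover have "finite ?B" by (intro finite_PiE) auto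
  moreover have "inj_on ?f ?A"
  proof (rule inj_onI, rule poly_mapping_eqI)
    fix x y p assume x: "x \<in> ?A" and y: "y \<in> ?A" and eq: "?f x = ?f y"
    show "Poly_Mapping.lookup x p = Poly_Mapping.lookup y p"
    proof (cases "p \<in> ?I")
      case True
      then show ?thesis using eq by (metis restrict_apply')
    next
      case False
      then have "p \<notin> Poly_Mapping.keys x" "p \<notin> Poly_Mapping.keys y"
        using x y by (auto simp: gt_polytope_def)
      then show ?thesis by (simp add: in_keys_iff)
    qed
  qed
  ultimately show ?thesis by (meson finite_imageD finite_subset)
qed

lemma gt_integer_hull_integral: "integral_polytope (gt_integer_hull m n lam mu w)"
proof -
  have "finite (gt_weight_polytope m n lam mu w \<inter> integer_points)"
    by (rule finite_subset[OF _ finite_gt_integer_points]) (auto simp: gt_weight_polytope_def)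
  then show ?thesis
    unfolding integral_polytope_def gt_integer_hull_def polytope_def
    using extreme_point_of_convex_hull by blast
qed

end

theory Submission
  imports Defs
begin

(*
  The skew shape is the disjoint union of a row of five boxes and three columns of heights 2, 3, 4.
  The pairs of column fillings 34/56, 235/467 and 1245/3678 are edges of the Gelfand--Tsetlin
  polytopes of the columns; call their parameters x, y, z, equal to 1 at the first filling.  On the
  face where every column runs along its edge, the row of boxes has to supply the
  remaining letters, so for each letter the weight only imposes an upper bound on its number in the
  columns.  For the letters 3, 4, 5, 6 the bound 2 reads x + y - z <= 1, x - y + z <= 1,
  - x + y + z <= 1, x + y + z >= 1, which cuts out the tetrahedron with vertices
  111, 100, 010, 001.  The other letters exclude nothing.  The centre of this tetrahedron, doubled,
  gives a lattice point of the second dilate.  It is not a sum of two lattice points, since no two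
  vertices of the tetrahedron are antipodal in the cube.
*)

section \<open>Weight polytopes: convexity, and lattice points from tableaux\<close>

lemma lookup_scaleR:
  fixes x :: "'i \<Rightarrow>\<^sub>0 real"
  shows "Poly_Mapping.lookup (r *\<^sub>R x) p = r * Poly_Mapping.lookup x p"
proof -
  have "finite {i. r *\<^sub>R Poly_Mapping.lookup x i \<noteq> 0}"
    by (rule finite_subset[of _ "Poly_Mapping.keys x"]) (auto simp: in_keys_iff)
  then show ?thesis
    by (simp add: scaleR_poly_mapping_def)
qed

text \<open>Puts the hull of the lattice points inside the weight polytope, so that the defining
  inequalities apply to summands taken from the hull.\<close>

lemma convex_gt_weight_polytope: "convex (gt_weight_polytope m n lam mu w)"
proof (rule convexI)
  fix x y :: array and u v :: real
  assume x: "x \<in> gt_weight_polytope m n lam mu w" and y: "y \<in> gt_weight_polytope m n lam mu w"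
    and uv: "0 \<le> u" "0 \<le> v" "u + v = 1"
  let ?z = "u *\<^sub>R x + v *\<^sub>R y"
  have z: "entry ?z i j = u * entry x i j + v * entry y i j" for i j
    by (simp add: lookup_add lookup_scaleR)
  have const: "u * c + v * c = c" for c
    using uv(3) by (metis distrib_right mult_1)
  have "Poly_Mapping.keys x \<subseteq> {0..m} \<times> {1..n}" "Poly_Mapping.keys y \<subseteq> {0..m} \<times> {1..n}"
    using x y by (simp_all add: gt_weight_polytope_def gt_polytope_def)
  moreover have "Poly_Mapping.keys ?z \<subseteq> Poly_Mapping.keys x \<union> Poly_Mapping.keys y"
    by (auto simp: in_keys_iff lookup_add lookup_scaleR)
  ultimately have "Poly_Mapping.keys ?z \<subseteq> {0..m} \<times> {1..n}"
    by blast
  moreover have "(\<Sum>j=1..n. entry ?z i j) = of_int (w i)" if "i \<in> {1..m}" for i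
  proof -
    have "(\<Sum>j=1..n. entry ?z i j) = u * (\<Sum>j=1..n. entry x i j) + v * (\<Sum>j=1..n. entry y i j)"
      by (simp add: z sum.distrib sum_distrib_left)
    then show ?thesis
      using x y that const by (simp add: gt_weight_polytope_def)
  qed
  moreover have "\<forall>i\<in>{0..m}. \<forall>j\<in>{1..n}. 0 \<le> entry ?z i j"
    using x y uv(1,2) unfolding z by (simp add: gt_weight_polytope_def gt_polytope_def)
  moreover have "\<forall>i j. i < m \<and> 1 \<le> j \<and> j \<le> n \<longrightarrow> entry ?z (i + 1) j \<ge> entry ?z i j"
    "\<forall>i j. i < m \<and> 1 \<le> j \<and> j < n \<longrightarrow> entry ?z i j \<ge> entry ?z (i + 1) (j + 1)"
    using x y uv(1,2) unfolding z
    by (simp_all add: gt_weight_polytope_def gt_polytope_def add_mono mult_left_mono)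
  moreover have "\<forall>j\<in>{1..n}. entry ?z m j = real (lam j)" "\<forall>j\<in>{1..n}. entry ?z 0 j = real (mu j)"
    using x y const unfolding z by (simp_all add: gt_weight_polytope_def gt_polytope_def)
  ultimately show "?z \<in> gt_weight_polytope m n lam mu w"
    by (simp add: gt_weight_polytope_def gt_polytope_def)
qed

(* The usual bijection of Gelfand--Tsetlin patterns with tableaux: row j of the skew tableau is the
  list T ! (j - 1) of its letters, and row i of the pattern is the shape filled by the letters <= i. *)

definition tableau_entry :: "(nat \<Rightarrow> nat) \<Rightarrow> nat list list \<Rightarrow> nat \<Rightarrow> nat \<Rightarrow> nat"
  where "tableau_entry mu T i j = mu j + length (filter (\<lambda>c. c \<le> i) (T ! (j - 1)))"

definition tableau_array :: "nat \<Rightarrow> nat \<Rightarrow> (nat \<Rightarrow> nat) \<Rightarrow> nat list list \<Rightarrow> array"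
  where "tableau_array m n mu T =
    Abs_poly_mapping (\<lambda>(i, j). if i \<le> m \<and> j \<in> {1..n} then real (tableau_entry mu T i j) else 0)"

lemma lookup_tableau_array:
  "entry (tableau_array m n mu T) i j =
    (if i \<le> m \<and> j \<in> {1..n} then real (tableau_entry mu T i j) else 0)"
proof -
  let ?f = "\<lambda>(i, j). if i \<le> m \<and> j \<in> {1..n} then real (tableau_entry mu T i j) else 0"
  have "finite {p. ?f p \<noteq> 0}"
    by (rule finite_subset[of _ "{..m} \<times> {1..n}"]) (auto split: if_splits)
  then show ?thesis
    by (simp add: tableau_array_def)
qed

lemma tableau_array_integer: "tableau_array m n mu T \<in> integer_points"
  by (auto simp: integer_points_def lookup_tableau_array)

text \<open>Here \<open>w i\<close> is the size of the shape reached at letter i, boxes of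
  \<open>mu\<close> included, not the multiplicity of i. The first conjunct is strictness down
  columns. All conditions are finite checks on naturals.\<close>

definition tableau_of_weight ::
    "nat \<Rightarrow> nat \<Rightarrow> (nat \<Rightarrow> nat) \<Rightarrow> (nat \<Rightarrow> nat) \<Rightarrow> (nat \<Rightarrow> nat) \<Rightarrow> nat list list \<Rightarrow> bool"
  where "tableau_of_weight m n lam mu w T \<longleftrightarrow>
    (\<forall>i\<in>{..<m}. \<forall>j\<in>{1..<n}. tableau_entry mu T (i + 1) (j + 1) \<le> tableau_entry mu T i j) \<and>
    (\<forall>j\<in>{1..n}. tableau_entry mu T m j = lam j \<and> tableau_entry mu T 0 j = mu j) \<and>
    (\<forall>i\<in>{1..m}. (\<Sum>j=1..n. tableau_entry mu T i j) = w i)"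

lemma tableau_entry_mono: "tableau_entry mu T i j \<le> tableau_entry mu T (Suc i) j"
proof -
  have "length (filter (\<lambda>c. c \<le> i) xs) \<le> length (filter (\<lambda>c. c \<le> Suc i) xs)" for xs :: "nat list"
    by (induction xs) auto
  then show ?thesis by (simp add: tableau_entry_def)
qed

lemma tableau_array_in_gt_weight_polytope:
  assumes "tableau_of_weight m n lam mu w T"
  shows "tableau_array m n mu T \<in> gt_weight_polytope m n lam mu (\<lambda>i. int (w i))"
proof -
  have "Poly_Mapping.keys (tableau_array m n mu T) \<subseteq> {0..m} \<times> {1..n}"
    by (auto simp: in_keys_iff lookup_tableau_array split: if_splits)
  moreover have "(\<Sum>j=1..n. entry (tableau_array m n mu T) i j) = real (w i)" if "i \<in> {1..m}" for i
  proof -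
    have "(\<Sum>j=1..n. entry (tableau_array m n mu T) i j) = real (\<Sum>j=1..n. tableau_entry mu T i j)"
      using that by (simp add: lookup_tableau_array)
    moreover have "(\<Sum>j=1..n. tableau_entry mu T i j) = w i"
      using assms that unfolding tableau_of_weight_def by blast
    ultimately show ?thesis
      by (simp only:)
  qed
  ultimately show ?thesis
    using assms
    by (auto simp: gt_weight_polytope_def gt_polytope_def tableau_of_weight_def lookup_tableau_array
        tableau_entry_mono)
qed

section \<open>Tight inequalities of sums\<close>

lemma gt_polytope_entry_mono:
  assumes "x \<in> gt_polytope m n lam mu" "j \<in> {1..n}" "i \<le> k" "k \<le> m"
  shows "entry x i j \<le> entry x k j"
  using assms(3,4)
proof (induction rule: dec_induct)
  case base
  then show ?case by simp
next
  case (step k)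
  have "entry x k j \<le> entry x (Suc k) j"
    using assms(1,2) step by (simp add: gt_polytope_def)
  then show ?case using step by linarith
qed

(* If an inequality is tight at a + b, then it is tight at a and at b: the summands lie in the
  smallest face (of the dilate) containing the sum. *)

lemma gt_summand_eq_vertical:
  assumes "a \<in> gt_polytope m n lam mu" "b \<in> gt_polytope m n lam mu" "j \<in> {1..n}" "i \<le> k" "k \<le> m"
    and "entry (a + b) k j = entry (a + b) i j"
  shows "entry a k j = entry a i j"
proof -
  have "entry a i j \<le> entry a k j" "entry b i j \<le> entry b k j"
    using assms(1-5) by (auto intro: gt_polytope_entry_mono)
  then show ?thesis using assms(6) by (simp add: lookup_add)
qed

lemma gt_summand_eq_diagonal:
  assumes "a \<in> gt_polytope m n lam mu" "b \<in> gt_polytope m n lam mu" "i < m" "j \<in> {1..<n}"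
    and "entry (a + b) (i + 1) (j + 1) = entry (a + b) i j"
  shows "entry a (i + 1) (j + 1) = entry a i j"
proof -
  have "entry a i j \<ge> entry a (i + 1) (j + 1)" "entry b i j \<ge> entry b (i + 1) (j + 1)"
    using assms(1-4) by (auto simp: gt_polytope_def)
  then show ?thesis using assms(5) by (simp add: lookup_add)
qed

section \<open>The skew shape, its weight and its tableaux\<close>

text \<open>Row 1 of the skew shape is the row of five boxes; rows 2-3, 4-6 and 7-10 are the
  columns.\<close>

definition ex_lam :: "nat \<Rightarrow> nat"
  where "ex_lam j = [8, 3, 3, 2, 2, 2, 1, 1, 1, 1] ! (j - 1)"

definition ex_mu :: "nat \<Rightarrow> nat"
  where "ex_mu j = [3, 2, 2, 1, 1, 1, 0, 0, 0, 0] ! (j - 1)"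

text \<open>Cumulative, starting from the 10 boxes of \<open>ex_mu\<close>: letters 1 and 8 occur
  once, letters 2 to 7 twice.\<close>

definition ex_weight :: "nat \<Rightarrow> nat"
  where "ex_weight i = [11, 13, 15, 17, 19, 21, 23, 24] ! (i - 1)"

text \<open>The suffix of each of the four names is its vertex (x, y, z), which fixes the columns;
  row 1 holds the remaining letters.\<close>

definition ex_tab111 :: "nat list list"
  where "ex_tab111 = [[6, 6, 7, 7, 8], [3], [4], [2], [3], [5], [1], [2], [4], [5]]"

definition ex_tab100 :: "nat list list"
  where "ex_tab100 = [[1, 2, 2, 5, 5], [3], [4], [4], [6], [7], [3], [6], [7], [8]]"

definition ex_tab010 :: "nat list list"
  where "ex_tab010 = [[1, 2, 4, 4, 7], [5], [6], [2], [3], [5], [3], [6], [7], [8]]"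

definition ex_tab001 :: "nat list list"
  where "ex_tab001 = [[2, 3, 3, 7, 8], [5], [6], [4], [6], [7], [1], [2], [4], [5]]"

text \<open>Row by row, half the multiset of letters of the four tableaux above. It fills the
  doubled shape, hence the inner shape \<open>2 * ex_mu\<close> in \<open>ex_point\<close>.\<close>

definition ex_tab2 :: "nat list list"
  where "ex_tab2 = [[1, 2, 2, 3, 4, 5, 6, 7, 7, 8],
    [3, 5], [4, 6], [2, 4], [3, 6], [5, 7], [1, 3], [2, 6], [4, 7], [5, 8]]"

abbreviation ex_polytope :: "array set"
  where "ex_polytope \<equiv> gt_weight_polytope 8 10 ex_lam ex_mu (\<lambda>i. int (ex_weight i))"

abbreviation ex_hull :: "array set"
  where "ex_hull \<equiv> gt_integer_hull 8 10 ex_lam ex_mu (\<lambda>i. int (ex_weight i))"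

abbreviation ex_point :: array
  where "ex_point \<equiv> tableau_array 8 10 (\<lambda>j. 2 * ex_mu j) ex_tab2"

lemma ex_ranges:
  "{..<8::nat} = {0, 1, 2, 3, 4, 5, 6, 7}" "{..8::nat} = {0, 1, 2, 3, 4, 5, 6, 7, 8}"
  "{1..8::nat} = {1, 2, 3, 4, 5, 6, 7, 8}"
  "{1..<10::nat} = {1, 2, 3, 4, 5, 6, 7, 8, 9}" "{1..10::nat} = {1, 2, 3, 4, 5, 6, 7, 8, 9, 10}"
  unfolding set_eq_iff by (simp_all, presburger+)

lemma ex_tableaux:
  "tableau_of_weight 8 10 ex_lam ex_mu ex_weight ex_tab111"
  "tableau_of_weight 8 10 ex_lam ex_mu ex_weight ex_tab100"
  "tableau_of_weight 8 10 ex_lam ex_mu ex_weight ex_tab010"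
  "tableau_of_weight 8 10 ex_lam ex_mu ex_weight ex_tab001"
  unfolding tableau_of_weight_def ex_ranges
  by (simp_all add: tableau_entry_def ex_lam_def ex_mu_def ex_weight_def
      ex_tab111_def ex_tab100_def ex_tab010_def ex_tab001_def)

text \<open>Twice the average of four points is half their sum; the factor 2 on the left clears that
  half.\<close>

lemma ex_tab2_entry:
  "\<forall>i\<in>{..8}. \<forall>j\<in>{1..10}. 2 * tableau_entry (\<lambda>j. 2 * ex_mu j) ex_tab2 i j =
    tableau_entry ex_mu ex_tab111 i j + tableau_entry ex_mu ex_tab100 i j +
    tableau_entry ex_mu ex_tab010 i j + tableau_entry ex_mu ex_tab001 i j"
  unfolding ex_ranges
  by (simp add: tableau_entry_def ex_mu_def ex_tab2_def
      ex_tab111_def ex_tab100_def ex_tab010_def ex_tab001_def)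

lemma ex_point_in_dilated_hull: "ex_point \<in> (\<lambda>z. real 2 *\<^sub>R z) ` ex_hull"
proof -
  let ?A = "\<lambda>T. tableau_array 8 10 ex_mu T"
  let ?mid = "\<lambda>x y :: array. (1/2) *\<^sub>R x + (1/2) *\<^sub>R y"
  let ?z = "?mid (?mid (?A ex_tab111) (?A ex_tab100)) (?mid (?A ex_tab010) (?A ex_tab001))"
  have tab: "?A T \<in> ex_hull" if "tableau_of_weight 8 10 ex_lam ex_mu ex_weight T" for T
    using tableau_array_in_gt_weight_polytope[OF that] tableau_array_integer
    by (auto simp: gt_integer_hull_def intro: hull_inc)
  have mid: "?mid x y \<in> ex_hull" if "x \<in> ex_hull" "y \<in> ex_hull" for x y
    using convexD[OF convex_convex_hull, of _ _ _ "1/2" "1/2"] that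
    by (simp add: gt_integer_hull_def)
  have "ex_point = real 2 *\<^sub>R ?z"
  proof (rule poly_mapping_eqI)
    fix p :: "nat \<times> nat"
    obtain i j where p: "p = (i, j)" by fastforce
    show "Poly_Mapping.lookup ex_point p = Poly_Mapping.lookup (real 2 *\<^sub>R ?z) p"
    proof (cases "i \<le> 8 \<and> j \<in> {1..10}")
      case True
      then have "real (2 * tableau_entry (\<lambda>j. 2 * ex_mu j) ex_tab2 i j) =
          real (tableau_entry ex_mu ex_tab111 i j + tableau_entry ex_mu ex_tab100 i j +
            tableau_entry ex_mu ex_tab010 i j + tableau_entry ex_mu ex_tab001 i j)"
        using ex_tab2_entry by (metis atMost_iff)
      then show ?thesis
        using True by (simp add: p lookup_add lookup_scaleR lookup_tableau_array field_simps)
    next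
      case False
      then show ?thesis
        by (auto simp: p lookup_add lookup_scaleR lookup_tableau_array)
    qed
  qed
  moreover have "?z \<in> ex_hull"
    by (intro mid tab ex_tableaux)
  ultimately show ?thesis by blast
qed

section \<open>Two-term decompositions of the doubled centre\<close>

text \<open>Holds for real summands; integrality enters only in the theorem. Each parameter is read
  off the first box of its column, at the first letter (3, 2 or 1) of the first filling, after
  removing the part from \<open>ex_mu\<close>.\<close>

lemma ex_summand:
  assumes a: "a \<in> ex_polytope" and b: "b \<in> ex_polytope" and ab: "a + b = ex_point"
  defines "x \<equiv> entry a 3 2 - 2" and "y \<equiv> entry a 2 4 - 1" and "z \<equiv> entry a 1 7"
  shows "0 \<le> x" "0 \<le> y" "0 \<le> z"
    and "x + y - z \<le> 1" "x - y + z \<le> 1" "- x + y + z \<le> 1" "1 \<le> x + y + z"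
proof -
  note defs = tableau_entry_def ex_tab2_def ex_mu_def ex_lam_def
  have G: "a \<in> gt_polytope 8 10 ex_lam ex_mu" "b \<in> gt_polytope 8 10 ex_lam ex_mu"
    using a b by (auto simp: gt_weight_polytope_def)
  \<comment> \<open>Between the letters of row j of \<open>ex_tab2\<close> the entries of
    \<open>ex_point\<close> stay constant, so those of \<open>a\<close> do too.\<close>
  have vert: "entry a k j = entry a i j"
    if "j \<in> {1..10}" "i \<le> k" "k \<le> 8" "tableau_entry (\<lambda>j. 2 * ex_mu j) ex_tab2 k j =
      tableau_entry (\<lambda>j. 2 * ex_mu j) ex_tab2 i j" for i j k
    using gt_summand_eq_vertical[OF G that(1-3)] that by (simp add: ab lookup_tableau_array)
  have diag: "entry a k l = entry a i j"
    if "i < 8" "j \<in> {1..<10}" "k = i + 1" "l = j + 1" "tableau_entry (\<lambda>j. 2 * ex_mu j) ex_tab2 k l =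
      tableau_entry (\<lambda>j. 2 * ex_mu j) ex_tab2 i j" for i j k l
    using gt_summand_eq_diagonal[OF G that(1,2)] that by (simp add: ab lookup_tableau_array)
  have bot: "entry a 0 j = real (ex_mu j)" and top: "entry a 8 j = real (ex_lam j)"
    if "j \<in> {1..10}" for j
    using G that by (auto simp: gt_polytope_def)
  have low: "entry a i j = real (ex_mu j)"
    if "j \<in> {1..10}" "i \<le> 8" "tableau_entry (\<lambda>j. 2 * ex_mu j) ex_tab2 i j =
      tableau_entry (\<lambda>j. 2 * ex_mu j) ex_tab2 0 j" for i j
    using vert[OF that(1) _ that(2,3)] bot[OF that(1)] by simp
  have high: "entry a i j = real (ex_lam j)"
    if "j \<in> {1..10}" "i \<le> 8" "tableau_entry (\<lambda>j. 2 * ex_mu j) ex_tab2 8 j =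
      tableau_entry (\<lambda>j. 2 * ex_mu j) ex_tab2 i j" for i j
    using vert[OF that(1,2) _ that(3)] top[OF that(1)] by simp
  \<comment> \<open>One equation for each pair of adjacent boxes in a column; with
    \<open>vert\<close> they leave one parameter per column.\<close>
  have diags: "entry a 4 3 = entry a 3 2" "entry a 3 5 = entry a 2 4" "entry a 5 6 = entry a 4 5"
    "entry a 2 8 = entry a 1 7" "entry a 4 9 = entry a 3 8" "entry a 5 10 = entry a 4 9"
    by (rule diag; simp add: defs)+
  have reps: "entry a 3 2 = 2 + x" "entry a 2 4 = 1 + y" "entry a 1 7 = z"
    by (simp_all add: x_def y_def z_def)
  \<comment> \<open>Letters 3 to 6 are counted by differences of rows 2 to 6, so only these rows are
    computed.\<close>
  have c2: "entry a 2 2 = 2" "entry a 3 2 = 2 + x" "entry a 4 2 = 2 + x"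
    "entry a 5 2 = 3" "entry a 6 2 = 3"
    using low[of 2 2] vert[of 2 3 4] high[of 2 5] high[of 2 6] reps(1)
    by (simp_all add: defs)
  have c3: "entry a 2 3 = 2" "entry a 3 3 = 2" "entry a 4 3 = 2 + x"
    "entry a 5 3 = 2 + x" "entry a 6 3 = 3"
    using low[of 3 2] low[of 3 3] vert[of 3 4 5] high[of 3 6] diags(1) reps(1)
    by (simp_all add: defs)
  have c4: "entry a 2 4 = 1 + y" "entry a 3 4 = 1 + y" "entry a 4 4 = 2"
    "entry a 5 4 = 2" "entry a 6 4 = 2"
    using vert[of 4 2 3] high[of 4 4] high[of 4 5] high[of 4 6] reps(2)
    by (simp_all add: defs)
  have c5: "entry a 2 5 = 1" "entry a 3 5 = 1 + y" "entry a 4 5 = 1 + y"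
    "entry a 5 5 = 1 + y" "entry a 6 5 = 2"
    using low[of 5 2] vert[of 5 3 4] vert[of 5 3 5] high[of 5 6] diags(2) reps(2)
    by (simp_all add: defs)
  have c6: "entry a 2 6 = 1" "entry a 3 6 = 1" "entry a 4 6 = 1"
    "entry a 5 6 = 1 + y" "entry a 6 6 = 1 + y"
    using low[of 6 2] low[of 6 3] low[of 6 4] vert[of 6 5 6] diags(3) c5
    by (simp_all add: defs)
  have c7: "entry a 2 7 = z" "entry a 3 7 = 1" "entry a 4 7 = 1"
    "entry a 5 7 = 1" "entry a 6 7 = 1"
    using vert[of 7 1 2] high[of 7 3] high[of 7 4] high[of 7 5] high[of 7 6] reps(3)
    by (simp_all add: defs)
  have c8: "entry a 2 8 = z" "entry a 3 8 = z" "entry a 4 8 = z"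
    "entry a 5 8 = z" "entry a 6 8 = 1"
    using vert[of 8 2 3] vert[of 8 2 4] vert[of 8 2 5] high[of 8 6] diags(4) reps(3)
    by (simp_all add: defs)
  have c9: "entry a 2 9 = 0" "entry a 3 9 = 0" "entry a 4 9 = z"
    "entry a 5 9 = z" "entry a 6 9 = z"
    using low[of 9 2] low[of 9 3] vert[of 9 4 5] vert[of 9 4 6] diags(5) c8
    by (simp_all add: defs)
  have c10: "entry a 2 10 = 0" "entry a 3 10 = 0" "entry a 4 10 = 0"
    "entry a 5 10 = z" "entry a 6 10 = z"
    using low[of 10 2] low[of 10 3] low[of 10 4] vert[of 10 5 6] diags(6) c9
    by (simp_all add: defs)
  have sums: "entry a i 1 + entry a i 2 + entry a i 3 + entry a i 4 + entry a i 5 + entry a i 6 +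
      entry a i 7 + entry a i 8 + entry a i 9 + entry a i 10 = real (ex_weight i)" if "i \<in> {1..8}" for i
    using a that unfolding gt_weight_polytope_def ex_ranges(5) by (simp add: add.assoc)
  have w: "real (ex_weight 2) = 13" "real (ex_weight 3) = 15" "real (ex_weight 4) = 17"
    "real (ex_weight 5) = 19" "real (ex_weight 6) = 21"
    by (simp_all add: ex_weight_def)
  have top_row: "entry a i 1 \<le> entry a (i + 1) 1" if "i < 8" for i
    using gt_polytope_entry_mono[OF G(1), of 1 i "i + 1"] that by simp
  note cs = c2 c3 c4 c5 c6 c7 c8 c9 c10
  \<comment> \<open>The row sums grow by 2 at each of the letters 3, 4, 5, 6. What the columns do
    not take is the growth of the first entry, which is nonnegative.\<close>
  show "x + y - z \<le> 1" "x - y + z \<le> 1" "- x + y + z \<le> 1" "1 \<le> x + y + z"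
    using sums[of 2] sums[of 3] sums[of 4] sums[of 5] sums[of 6]
      top_row[of 2] top_row[of 3] top_row[of 4] top_row[of 5]
    by (simp_all add: cs w)
  have bot_le: "real (ex_mu j) \<le> entry a i j" if "j \<in> {1..10}" "i \<le> 8" for i j
    using gt_polytope_entry_mono[OF G(1) that(1), of 0 i] that bot by simp
  show "0 \<le> x" "0 \<le> y" "0 \<le> z"
    using bot_le[of 2 3] bot_le[of 4 2] bot_le[of 7 1] by (simp_all add: x_def y_def z_def ex_mu_def)
qed

theorem proposition4:
  shows "\<exists>(m::nat) (n::nat) (lam :: nat \<Rightarrow> nat) (mu :: nat \<Rightarrow> nat) (w :: nat \<Rightarrow> int).
    0 < m \<and> 0 < n \<and> is_partition n lam \<and> is_partition n mu \<and> (\<forall>j\<in>{1..n}. mu j \<le> lam j) \<and>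
    \<not> integer_decomposition_property (gt_integer_hull m n lam mu w)"
proof (intro exI conjI)
  have "\<forall>j\<in>{1..<10}. ex_lam (j + 1) \<le> ex_lam j" "\<forall>j\<in>{1..<10}. ex_mu (j + 1) \<le> ex_mu j"
    by code_simp+
  then show "is_partition 10 ex_lam" "is_partition 10 ex_mu"
    by (auto simp: is_partition_def)
  show "\<forall>j\<in>{1..10}. ex_mu j \<le> ex_lam j"
    by code_simp
  show "\<not> integer_decomposition_property ex_hull"
  proof
    assume "integer_decomposition_property ex_hull"
    then obtain Y :: "nat \<Rightarrow> array" where Y: "\<forall>l\<in>{1..2}. Y l \<in> ex_hull \<inter> integer_points"
      and sum: "(\<Sum>l=1..2. Y l) = ex_point"
      using ex_point_in_dilated_hull tableau_array_integer
      unfolding integer_decomposition_property_def by (meson IntI zero_less_numeral)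
    have hull: "ex_hull \<subseteq> ex_polytope"
      unfolding gt_integer_hull_def by (intro hull_minimal convex_gt_weight_polytope) blast
    define a b where "a = Y 1" and "b = Y 2"
    have a: "a \<in> ex_polytope" "a \<in> integer_points" and b: "b \<in> ex_polytope"
      using Y hull by (auto simp: a_def b_def)
    have ab: "a + b = ex_point" "b + a = ex_point"
      using sum by (simp_all add: a_def b_def eval_nat_numeral add.commute)
    have "entry a i j \<in> \<int>" for i j
      using a(2) by (simp add: integer_points_def)
    then obtain p q r where pqr: "entry a 3 2 = of_int p" "entry a 2 4 = of_int q" "entry a 1 7 = of_int r"
      by (meson Ints_cases)
    have "entry a i j + entry b i j = entry ex_point i j" for i j
      by (metis ab(1) lookup_add)
    from this[of 3 2] this[of 2 4] this[of 1 7]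
    have b_entries: "entry b 3 2 = 5 - of_int p" "entry b 2 4 = 3 - of_int q" "entry b 1 7 = 1 - of_int r"
      using pqr by (simp_all add: lookup_tableau_array tableau_entry_def ex_tab2_def ex_mu_def)
    \<comment> \<open>The parameters of \<open>b\<close> are 1 - x, 1 - y, 1 - z, so nonnegativity
      for both summands forces values 0 or 1.\<close>
    note ineqs = ex_summand[OF a(1) b ab(1), unfolded pqr] ex_summand[OF b a(1) ab(2), unfolded b_entries]
    have "p \<in> {2, 3}" "q \<in> {1, 2}" "r \<in> {0, 1}"
      using ineqs by auto
    \<comment> \<open>Of two complementary 0/1 vectors, one has an even number of ones and violates
      one of the four bounds.\<close>
    then show False
      using ineqs by auto
  qed
qed simp_all

end
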